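(* For all integers $n\ge d\ge 4$, the set $\Pi_{n,d}$ is not contained in $\operatorname{conv}\left\{\left(\frac1k,\frac1{k^2},\dots,\frac1{k^{d-1}}\right):k\in\{1,\dots,n\}\right\}$. Moreover, for all $d\geq 4$, $\Pi_d\not\subseteq\operatorname{conv}\left(\{(0,\dots,0)\}\cup\left\{\left(\frac1k,\frac1{k^2},\dots,\frac1{k^{d-1}}\right):k\in\mathbb{N}_{>0}\right\}\right)$.
   Context: $\Delta_{n-1}=\{x\in\mathbb{R}^n_{\geq 0}: x_1+\dots+x_n=1\}$, $p_k(x)=\sum_{i=1}^n x_i^k$, $\Pi_{n,d}=(p_2,\dots,p_d)(\Delta_{n-1})\subset\mathbb{R}^{d-1}$, and $\Pi_d$ is the closure of $\bigcup_{n\ge d}\Pi_{n,d}$. *)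

theory Defs
  imports "HOL-Analysis.Analysis" "HOL-Homology.Simplices"
begin

definition power_sum :: "nat \<Rightarrow> nat \<Rightarrow> (nat \<Rightarrow> real) \<Rightarrow> real"
  where "power_sum n k x = (\<Sum>i<n. x i ^ k)"

text \<open>
  The space of real \<open>(d - 1)\<close>-tuples is rendered as \<open>real ^ 'm\<close> together with a bijection
  \<open>c :: 'm \<Rightarrow> nat\<close> onto \<open>{2..d}\<close> that labels its coordinates by the exponents
  \<open>2, \<dots>, d\<close>: the coordinate \<open>i\<close> of the tuple \<open>(p\<^sub>2, \<dots>, p\<^sub>d)\<close> is the power sum of
  exponent \<open>c i\<close>. The parameter \<open>d\<close> is thus carried by \<open>c\<close>.

  The library's \<open>standard_simplex (n - 1)\<close> consists of the nonnegative sequences supported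
  on \<open>{..n - 1}\<close> with sum 1, so the \<open>n\<close> variables are numbered from 0.
\<close>

definition vandermonde_cell :: "('m::finite \<Rightarrow> nat) \<Rightarrow> nat \<Rightarrow> (real ^ 'm) set"
  where "vandermonde_cell c n = (\<lambda>x. \<chi> i. power_sum n (c i) x) ` standard_simplex (n - 1)"

definition vandermonde_limit_cell :: "('m::finite \<Rightarrow> nat) \<Rightarrow> nat \<Rightarrow> (real ^ 'm) set"
  where "vandermonde_limit_cell c d = closure (\<Union>n\<in>{d..}. vandermonde_cell c n)"

text \<open>
  The point \<open>(1/k, 1/k^2, \<dots>, 1/k^(d - 1))\<close>: its \<open>j\<close>-th entry sits at the coordinate
  labelled by the exponent \<open>j + 1\<close>.
\<close>

definition curve_point :: "('m::finite \<Rightarrow> nat) \<Rightarrow> nat \<Rightarrow> real ^ 'm"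
  where "curve_point c k = (\<chi> i. 1 / real k ^ (c i - 1))"

end

theory Submission imports Defs begin

text \<open>
  On the simplex the coordinates of \<open>x\<close> sum to 1, so \<open>x\<close> is a probability measure on
  \<open>[0, 1]\<close> with mass \<open>x\<^sub>i\<close> at the point \<open>x\<^sub>i\<close>, and \<open>p\<^sub>k(x)\<close> is its \<open>(k - 1)\<close>-st
  moment. The point of the curve with parameter \<open>1/k\<close> is the moment vector of the unit mass at
  \<open>1/k\<close>. A polynomial \<open>q\<close> of degree at most \<open>d - 1\<close> that is nonnegative at \<open>0\<close> and
  at all \<open>1/k\<close> therefore gives an affine function that is nonnegative on both convex hulls and
  takes the value \<open>\<Sum>\<^sub>i x\<^sub>i q(x\<^sub>i)\<close> at the power sums of \<open>x\<close>.

  Such a \<open>q\<close> may be negative between two consecutive reciprocals. The cubic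
  \<open>q(t) = t (t - 1/2) (t - 1/3)\<close> is negative exactly on \<open>(1/3, 1/2)\<close> among the positive
  numbers, and its zero at \<open>0\<close> makes small coordinates nearly free of charge: at
  \<open>x = (1/2 - e, 1/2 - e, 2e)\<close> the two large coordinates contribute about \<open>- e/12\<close>,
  while the small one contributes only \<open>O(e\<^sup>2)\<close>. The choice \<open>e = 1/10\<close> is small enough.
  Since \<open>q\<close> is cubic, the exponents 2, 3 and 4 suffice, which is where \<open>d \<ge> 4\<close> is used, and
  since \<open>q(0) = 0\<close> is not negative, the origin may be added to the hull. Zeros appended to \<open>x\<close>
  do not change its power sums, so the same three numbers serve for all \<open>n\<close>.
\<close>

text \<open>
  The value of \<open>q\<close> at \<open>1/k\<close> is \<open>(k - 2) (k - 3) / (6 k\<^sup>3)\<close>, and no integer lies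
  strictly between 2 and 3.
\<close>

lemma cubic_nonneg_at_reciprocals:
  assumes "k > (0::nat)"
  shows "1 / real k ^ 3 - 5/6 * (1 / real k ^ 2) + 1/6 * (1 / real k) \<ge> 0"
proof -
  have "(real k - 2) * (real k - 3) \<ge> 0"
  proof (cases "k \<le> 2")
    case True
    then show ?thesis by (intro mult_nonpos_nonpos) auto
  next
    case False
    then show ?thesis by (intro mult_nonneg_nonneg) auto
  qed
  then have "(real k - 2) * (real k - 3) / (6 * real k ^ 3) \<ge> 0"
    by simp
  also have "(real k - 2) * (real k - 3) / (6 * real k ^ 3)
      = 1 / real k ^ 3 - 5/6 * (1 / real k ^ 2) + 1/6 * (1 / real k)"
    using assms by (simp add: field_simps power2_eq_square power3_eq_cube)
  finally show ?thesis .
qed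

lemma convex_hull_curve_points_subset_halfspace:
  fixes c :: "'m::finite \<Rightarrow> nat"
  assumes "c i2 = 2" "c i3 = 3" "c i4 = 4"
  shows "convex hull ({0} \<union> curve_point c ` {k. k > 0})
    \<subseteq> {v. v $ i4 - 5/6 * v $ i3 + 1/6 * v $ i2 \<ge> 0}"
proof (rule hull_minimal)
  show "{0} \<union> curve_point c ` {k. k > 0} \<subseteq> {v. v $ i4 - 5/6 * v $ i3 + 1/6 * v $ i2 \<ge> 0}"
    using assms cubic_nonneg_at_reciprocals by (auto simp: curve_point_def mult.commute)
  have "linear (\<lambda>v::real^'m. v $ i4 - 5/6 * v $ i3 + 1/6 * v $ i2)"
    by (rule linearI) (simp_all add: algebra_simps)
  then have "convex ((\<lambda>v::real^'m. v $ i4 - 5/6 * v $ i3 + 1/6 * v $ i2) -` {0..})"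
    by (rule convex_linear_vimage) simp
  then show "convex {v::real^'m. v $ i4 - 5/6 * v $ i3 + 1/6 * v $ i2 \<ge> 0}"
    by (simp add: vimage_def)
qed

lemma vandermonde_cell_leaves_halfspace:
  fixes c :: "'m::finite \<Rightarrow> nat"
  assumes "c i2 = 2" "c i3 = 3" "c i4 = 4" and "n \<ge> 3"
  obtains v where "v \<in> vandermonde_cell c n" "v $ i4 - 5/6 * v $ i3 + 1/6 * v $ i2 < 0"
proof -
  define x :: "nat \<Rightarrow> real"
    where "x = (\<lambda>i. if i < 2 then 2/5 else if i = 2 then 1/5 else 0)"
  have sums: "(\<Sum>i<m. x i ^ k) = 2 * (2/5) ^ k + (1/5) ^ k" if "m \<ge> 3" "k > 0" for m k
  proof -
    have "(\<Sum>i<m. x i ^ k) = (\<Sum>i<3. x i ^ k)"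
      by (rule sum.mono_neutral_right) (use that in \<open>auto simp: x_def\<close>)
    also have "\<dots> = 2 * (2/5) ^ k + (1/5) ^ k"
      by (simp add: x_def eval_nat_numeral)
    finally show ?thesis .
  qed
  have "{..n - 1} = {..<n}"
    using \<open>n \<ge> 3\<close> by auto
  moreover have "(\<Sum>i<n. x i) = 1"
    using \<open>n \<ge> 3\<close> sums[of n 1] by simp
  moreover have "0 \<le> x i \<and> x i \<le> 1" "i > n - 1 \<longrightarrow> x i = 0" for i
    using \<open>n \<ge> 3\<close> by (auto simp: x_def)
  ultimately have "x \<in> standard_simplex (n - 1)"
    by (simp add: standard_simplex_def)
  then have "(\<chi> i. power_sum n (c i) x) \<in> vandermonde_cell c n"
    by (simp add: vandermonde_cell_def)
  then show thesis
    by (rule that) (simp add: assms power_sum_def sums power_divide)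
qed

theorem proposition5p5:
  fixes d :: nat and c :: "'m::finite \<Rightarrow> nat"
  assumes "d \<ge> 4" and "bij_betw c UNIV {2..d}"
  shows "(\<forall>n\<ge>d. \<not> vandermonde_cell c n \<subseteq> convex hull (curve_point c ` {1..n})) \<and>
    \<not> vandermonde_limit_cell c d \<subseteq> convex hull ({0} \<union> curve_point c ` {k. k > 0})"
proof -
  let ?H = "convex hull ({0} \<union> curve_point c ` {k. k > 0})"
  have "k \<in> range c" if "k \<in> {2..d}" for k
    using assms(2) that by (simp add: bij_betw_def)
  from this[of 2] this[of 3] this[of 4]
  obtain i2 i3 i4 where i: "c i2 = 2" "c i3 = 3" "c i4 = 4"
    using \<open>d \<ge> 4\<close> by auto
  have cell: "\<not> vandermonde_cell c n \<subseteq> ?H" if "n \<ge> d" for n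
  proof -
    have "n \<ge> 3"
      using that \<open>d \<ge> 4\<close> by simp
    with i obtain v where "v \<in> vandermonde_cell c n" "v $ i4 - 5/6 * v $ i3 + 1/6 * v $ i2 < 0"
      by (rule vandermonde_cell_leaves_halfspace)
    then show ?thesis
      using convex_hull_curve_points_subset_halfspace[OF i] by fastforce
  qed
  have "convex hull (curve_point c ` {1..n}) \<subseteq> ?H" for n
    by (rule hull_mono) auto
  then have "\<forall>n\<ge>d. \<not> vandermonde_cell c n \<subseteq> convex hull (curve_point c ` {1..n})"
    using cell by blast
  moreover have "vandermonde_cell c d \<subseteq> vandermonde_limit_cell c d"
    unfolding vandermonde_limit_cell_def using closure_subset by fastforce
  ultimately show ?thesis
    using cell[of d] by blast
qed

end
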